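(* Let $X$ be a Dieudonné complete Tychonoff space. Then the free locally convex space $L(X)$ is semi-reflexive if and only if every compact subset of $X$ is finite.
   Context: $L(X)$: the free locally convex space over $X$ (the locally convex space containing $X$ as a topological subspace and Hamel basis such that every continuous map from $X$ into a locally convex space extends uniquely to a continuous linear map on $L(X)$); its dual is $C(X)$. A Tychonoff space is Dieudonné complete if it is complete with respect to its finest compatible uniformity. A locally convex space is semi-reflexive if every bounded subset is relatively weakly compact. *)

theory Defs
  imports "HOL-Analysis.Analysis"
begin

definition tychonoff_space :: "'a topology \<Rightarrow> bool" where
  "tychonoff_space X \<longleftrightarrow> completely_regular_space X \<and> t1_space X"

definition uniformity_on :: "'a set \<Rightarrow> ('a \<times> 'a) set set \<Rightarrow> bool" where
  "uniformity_on S U \<longleftrightarrow>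
     U \<noteq> {} \<and>
     (\<forall>V\<in>U. Id_on S \<subseteq> V \<and> V \<subseteq> S \<times> S) \<and>
     (\<forall>V W. V \<in> U \<and> V \<subseteq> W \<and> W \<subseteq> S \<times> S \<longrightarrow> W \<in> U) \<and>
     (\<forall>V\<in>U. \<forall>W\<in>U. V \<inter> W \<in> U) \<and>
     (\<forall>V\<in>U. V\<inverse> \<in> U) \<and>
     (\<forall>V\<in>U. \<exists>W\<in>U. W O W \<subseteq> V)"

definition compatible_uniformity :: "'a topology \<Rightarrow> ('a \<times> 'a) set set \<Rightarrow> bool" where
  "compatible_uniformity X U \<longleftrightarrow>
     uniformity_on (topspace X) U \<and>
     (\<forall>A. openin X A \<longleftrightarrow> A \<subseteq> topspace X \<and> (\<forall>x\<in>A. \<exists>V\<in>U. V `` {x} \<subseteq> A))"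

definition cauchy_filter_unif :: "'a set \<Rightarrow> ('a \<times> 'a) set set \<Rightarrow> 'a filter \<Rightarrow> bool" where
  "cauchy_filter_unif S U F \<longleftrightarrow>
     F \<noteq> bot \<and> eventually (\<lambda>x. x \<in> S) F \<and>
     (\<forall>V\<in>U. \<exists>A. eventually (\<lambda>x. x \<in> A) F \<and> A \<times> A \<subseteq> V)"

definition filter_converges_in :: "'a topology \<Rightarrow> 'a filter \<Rightarrow> bool" where
  "filter_converges_in X F \<longleftrightarrow>
     (\<exists>x\<in>topspace X. \<forall>N. openin X N \<and> x \<in> N \<longrightarrow> eventually (\<lambda>y. y \<in> N) F)"

definition complete_uniformity :: "'a topology \<Rightarrow> ('a \<times> 'a) set set \<Rightarrow> bool" where
  "complete_uniformity X U \<longleftrightarrow>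
     (\<forall>F. cauchy_filter_unif (topspace X) U F \<longrightarrow> filter_converges_in X F)"

definition dieudonne_complete :: "'a topology \<Rightarrow> bool" where
  "dieudonne_complete X \<longleftrightarrow>
     (\<exists>U. compatible_uniformity X U \<and>
          (\<forall>U'. compatible_uniformity X U' \<longrightarrow> U' \<subseteq> U) \<and>
          complete_uniformity X U)"

text \<open>Underlying vector space: finitely supported real functions on the points of X
  (Hamel basis: the Dirac functions).\<close>
definition flcs_carrier :: "'a topology \<Rightarrow> ('a \<Rightarrow> real) set" where
  "flcs_carrier X = {f. finite {x. f x \<noteq> 0} \<and> {x. f x \<noteq> 0} \<subseteq> topspace X}"

definition dirac :: "'a \<Rightarrow> 'a \<Rightarrow> real" where
  "dirac x = (\<lambda>y. if y = x then 1 else 0)"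

definition seminorm_on :: "('a \<Rightarrow> real) set \<Rightarrow> (('a \<Rightarrow> real) \<Rightarrow> real) \<Rightarrow> bool" where
  "seminorm_on V p \<longleftrightarrow>
     (\<forall>f\<in>V. 0 \<le> p f) \<and>
     (\<forall>f\<in>V. \<forall>c. p (\<lambda>x. c * f x) = \<bar>c\<bar> * p f) \<and>
     (\<forall>f\<in>V. \<forall>g\<in>V. p (\<lambda>x. f x + g x) \<le> p f + p g)"

definition flcs_seminorm :: "'a topology \<Rightarrow> (('a \<Rightarrow> real) \<Rightarrow> real) \<Rightarrow> bool" where
  "flcs_seminorm X p \<longleftrightarrow> seminorm_on (flcs_carrier X) p \<and>
     (\<forall>y\<in>topspace X. \<forall>e>0. \<exists>W. openin X W \<and> y \<in> W \<and>
        (\<forall>x\<in>W. p (\<lambda>z. dirac x z - dirac y z) < e))"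

text \<open>The free locally convex topology: the finest locally convex topology on the
  vector space making the embedding continuous, i.e. the topology generated by all
  such seminorms.  It satisfies the universal property of L(X).\<close>
definition flcs_topology :: "'a topology \<Rightarrow> ('a \<Rightarrow> real) topology" where
  "flcs_topology X = topology_generated_by
     {{g \<in> flcs_carrier X. p (\<lambda>z. g z - f z) < e} | p f e.
        flcs_seminorm X p \<and> f \<in> flcs_carrier X \<and> e > 0}"

definition flcs_bounded :: "'a topology \<Rightarrow> ('a \<Rightarrow> real) set \<Rightarrow> bool" where
  "flcs_bounded X B \<longleftrightarrow> B \<subseteq> flcs_carrier X \<and>
     (\<forall>N. openin (flcs_topology X) N \<and> (\<lambda>_. 0) \<in> N \<longrightarrow>
        (\<exists>t>0. \<forall>s. \<bar>s\<bar> \<ge> t \<longrightarrow> (\<forall>b\<in>B. (\<lambda>z. b z / s) \<in> N)))"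

definition flcs_dual :: "'a topology \<Rightarrow> (('a \<Rightarrow> real) \<Rightarrow> real) set" where
  "flcs_dual X = {\<phi>. continuous_map (flcs_topology X) euclideanreal \<phi> \<and>
      (\<forall>f\<in>flcs_carrier X. \<forall>g\<in>flcs_carrier X. \<phi> (\<lambda>z. f z + g z) = \<phi> f + \<phi> g) \<and>
      (\<forall>f\<in>flcs_carrier X. \<forall>c. \<phi> (\<lambda>z. c * f z) = c * \<phi> f)}"

definition flcs_weak_topology :: "'a topology \<Rightarrow> ('a \<Rightarrow> real) topology" where
  "flcs_weak_topology X = topology_generated_by
     {{f \<in> flcs_carrier X. \<phi> f \<in> T} | \<phi> T. \<phi> \<in> flcs_dual X \<and> open T}"

definition flcs_semireflexive :: "'a topology \<Rightarrow> bool" where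
  "flcs_semireflexive X \<longleftrightarrow>
     (\<forall>B. flcs_bounded X B \<longrightarrow>
        compactin (flcs_weak_topology X) (flcs_weak_topology X closure_of B))"

end

theory Submission
  imports Defs
begin

text \<open>
  If \<open>X\<close> has an infinite compact subset, choose distinct points \<open>x\<^sub>k\<close> in it. The partial sums of
  \<open>\<Sum>k. 2\<^sup>-\<^sup>k \<delta>(x\<^sub>k)\<close> form a bounded sequence of \<open>L(X)\<close>. A weak cluster point of it has finite support,
  missing some \<open>x\<^sub>m\<close>, and a nonnegative continuous function that is 1 at \<open>x\<^sub>m\<close> and 0 on this support
  separates it from all late members of the sequence.

  Conversely, the union \<open>A\<close> of the supports of a bounded set \<open>B\<close> is precompact for every compatible
  uniformity: otherwise there are \<open>b\<^sub>n \<in> B\<close>, points \<open>a\<^sub>n\<close> of the support of \<open>b\<^sub>n\<close>, and continuous \<open>g\<^sub>n\<close>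
  with \<open>g\<^sub>n(a\<^sub>n) = 1\<close> that vanish on the rest of the support of \<open>b\<^sub>n\<close> and outside the \<open>n\<close>-th member of a
  discrete family of open sets, and the continuous seminorm
  \<open>\<Sum>n. n \<bar>\<langle>g\<^sub>n, f\<rangle>\<bar> / \<bar>b\<^sub>n(a\<^sub>n)\<bar>\<close> is unbounded on \<open>B\<close>. By completeness the closure of \<open>A\<close> is compact, hence
  finite, so \<open>B\<close> lies in a bounded box of a finite-dimensional subspace, and this box is weakly
  compact.
\<close>

section \<open>The pairing of \<open>L(X)\<close> with \<open>C(X)\<close>\<close>

lemma flcs_carrier_zero: "(\<lambda>_. 0) \<in> flcs_carrier X"
  by (simp add: flcs_carrier_def)

lemma flcs_carrier_add:
  assumes "f \<in> flcs_carrier X" "g \<in> flcs_carrier X"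
  shows "(\<lambda>z. f z + g z) \<in> flcs_carrier X"
proof -
  have "{z. f z + g z \<noteq> 0} \<subseteq> {z. f z \<noteq> 0} \<union> {z. g z \<noteq> 0}" by auto
  then show ?thesis
    using assms unfolding flcs_carrier_def by (auto intro: finite_subset)
qed

lemma flcs_carrier_scale:
  assumes "f \<in> flcs_carrier X"
  shows "(\<lambda>z. c * f z) \<in> flcs_carrier X"
  using assms unfolding flcs_carrier_def by (auto elim: rev_finite_subset)

lemma flcs_carrier_diff:
  assumes "f \<in> flcs_carrier X" "g \<in> flcs_carrier X"
  shows "(\<lambda>z. f z - g z) \<in> flcs_carrier X"
  using flcs_carrier_add[OF assms(1) flcs_carrier_scale[OF assms(2), of "-1"]] by simp

lemma flcs_carrier_dirac:
  assumes "x \<in> topspace X"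
  shows "dirac x \<in> flcs_carrier X"
  using assms by (simp add: flcs_carrier_def dirac_def)

text \<open>The linear extension of \<open>h\<close> from the Dirac functions to
  \<open>L(X)\<close>, defined for arbitrary \<open>h\<close> so that its algebra involves no
  continuity.\<close>

definition pairing :: "('a \<Rightarrow> real) \<Rightarrow> ('a \<Rightarrow> real) \<Rightarrow> real" where
  "pairing h f = (\<Sum>x | f x \<noteq> 0. f x * h x)"

lemma pairing_eq_sum:
  assumes "finite A" "{x. f x \<noteq> 0} \<subseteq> A"
  shows "pairing h f = (\<Sum>x\<in>A. f x * h x)"
  unfolding pairing_def using assms by (intro sum.mono_neutral_left) auto

lemma pairing_dirac: "pairing h (dirac x) = h x"
  using pairing_eq_sum[of "{x}" "dirac x" h] by (auto simp: dirac_def)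

lemma pairing_add:
  assumes "f \<in> flcs_carrier X" "g \<in> flcs_carrier X"
  shows "pairing h (\<lambda>z. f z + g z) = pairing h f + pairing h g"
proof -
  let ?A = "{z. f z \<noteq> 0} \<union> {z. g z \<noteq> 0}"
  have "finite ?A" using assms by (simp add: flcs_carrier_def)
  then show ?thesis
    by (simp add: pairing_eq_sum[of ?A] subset_iff sum.distrib distrib_right)
qed

lemma pairing_scale:
  assumes "f \<in> flcs_carrier X"
  shows "pairing h (\<lambda>z. c * f z) = c * pairing h f"
proof -
  have "finite {z. f z \<noteq> 0}" using assms by (simp add: flcs_carrier_def)
  then show ?thesis
    by (simp add: pairing_eq_sum[of "{z. f z \<noteq> 0}"] subset_iff sum_distrib_left mult.assoc)
qed

lemma pairing_diff:
  assumes "f \<in> flcs_carrier X" "g \<in> flcs_carrier X"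
  shows "pairing h (\<lambda>z. f z - g z) = pairing h f - pairing h g"
  using pairing_add[OF assms(1) flcs_carrier_scale[OF assms(2), of "-1"], of h]
    pairing_scale[OF assms(2), of h "-1"] by simp

section \<open>Continuous seminorms\<close>

lemma flcs_seminorm_nonneg:
  "flcs_seminorm X p \<Longrightarrow> f \<in> flcs_carrier X \<Longrightarrow> 0 \<le> p f"
  by (simp add: flcs_seminorm_def seminorm_on_def)

lemma flcs_seminorm_scale:
  "flcs_seminorm X p \<Longrightarrow> f \<in> flcs_carrier X \<Longrightarrow> p (\<lambda>z. c * f z) = \<bar>c\<bar> * p f"
  by (simp add: flcs_seminorm_def seminorm_on_def)

lemma flcs_seminorm_triangle:
  "flcs_seminorm X p \<Longrightarrow> f \<in> flcs_carrier X \<Longrightarrow> g \<in> flcs_carrier X \<Longrightarrow>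
    p (\<lambda>z. f z + g z) \<le> p f + p g"
  by (simp add: flcs_seminorm_def seminorm_on_def)

lemma flcs_seminorm_zero:
  "flcs_seminorm X p \<Longrightarrow> p (\<lambda>_. 0) = 0"
  using flcs_seminorm_scale[OF _ flcs_carrier_zero, of X p 0] by simp

lemma flcs_seminorm_triangle_diff:
  assumes "flcs_seminorm X p" "f \<in> flcs_carrier X" "g \<in> flcs_carrier X" "h \<in> flcs_carrier X"
  shows "p (\<lambda>z. f z - h z) \<le> p (\<lambda>z. f z - g z) + p (\<lambda>z. g z - h z)"
  using flcs_seminorm_triangle[OF assms(1) flcs_carrier_diff[OF assms(2,3)]
      flcs_carrier_diff[OF assms(3,4)]] by simp

lemma flcs_seminorm_const_0: "flcs_seminorm X (\<lambda>_. 0)"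
  unfolding flcs_seminorm_def seminorm_on_def using openin_topspace by auto

text \<open>Sums make the continuous seminorms directed: a ball of the sum lies in the balls of both
  summands, which handles intersections of open sets.\<close>

lemma flcs_seminorm_add:
  assumes p: "flcs_seminorm X p" and q: "flcs_seminorm X q"
  shows "flcs_seminorm X (\<lambda>f. p f + q f)"
  unfolding flcs_seminorm_def seminorm_on_def
proof (intro conjI ballI allI impI)
  fix f g c assume f: "f \<in> flcs_carrier X"
  show "0 \<le> p f + q f" using flcs_seminorm_nonneg[OF p f] flcs_seminorm_nonneg[OF q f] by simp
  show "p (\<lambda>x. c * f x) + q (\<lambda>x. c * f x) = \<bar>c\<bar> * (p f + q f)"
    using flcs_seminorm_scale[OF p f] flcs_seminorm_scale[OF q f] by (simp add: distrib_left)
  assume g: "g \<in> flcs_carrier X"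
  show "p (\<lambda>x. f x + g x) + q (\<lambda>x. f x + g x) \<le> p f + q f + (p g + q g)"
    using flcs_seminorm_triangle[OF p f g] flcs_seminorm_triangle[OF q f g] by simp
next
  fix y and e :: real assume y: "y \<in> topspace X" and e: "0 < e"
  obtain V where V: "openin X V" "y \<in> V" "\<And>x. x \<in> V \<Longrightarrow> p (\<lambda>z. dirac x z - dirac y z) < e/2"
    using p y e unfolding flcs_seminorm_def by (meson half_gt_zero)
  obtain W where W: "openin X W" "y \<in> W" "\<And>x. x \<in> W \<Longrightarrow> q (\<lambda>z. dirac x z - dirac y z) < e/2"
    using q y e unfolding flcs_seminorm_def by (meson half_gt_zero)
  show "\<exists>W. openin X W \<and> y \<in> W \<and>
      (\<forall>x\<in>W. p (\<lambda>z. dirac x z - dirac y z) + q (\<lambda>z. dirac x z - dirac y z) < e)"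
    using V(1,2) W(1,2) add_strict_mono[OF V(3) W(3)]
    by (intro exI[of _ "V \<inter> W"]) (simp add: openin_Int)
qed

text \<open>Only finitely many terms are nonzero at \<open>f\<close>, because its support is finite
  and each point sees finitely many \<open>h i\<close>. The index set is cut down to the nonzero
  terms because a sum over an infinite set is 0 by default.\<close>

lemma flcs_seminorm_sum_pairing:
  fixes h :: "'i \<Rightarrow> 'a \<Rightarrow> real"
  assumes cont: "\<And>i. continuous_map X euclideanreal (h i)"
    and lf: "\<And>y. y \<in> topspace X \<Longrightarrow> \<exists>W. openin X W \<and> y \<in> W \<and> finite {i. \<exists>x\<in>W. h i x \<noteq> 0}"
  shows "flcs_seminorm X (\<lambda>f. \<Sum>i | pairing (h i) f \<noteq> 0. \<bar>pairing (h i) f\<bar>)"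
    and "f \<in> flcs_carrier X \<Longrightarrow> finite {i. pairing (h i) f \<noteq> 0}"
proof -
  have fin: "finite {i. pairing (h i) f \<noteq> 0}" if f: "f \<in> flcs_carrier X" for f
  proof (rule finite_subset)
    show "{i. pairing (h i) f \<noteq> 0} \<subseteq> (\<Union>x\<in>{x. f x \<noteq> 0}. {i. h i x \<noteq> 0})"
    proof
      fix i assume "i \<in> {i. pairing (h i) f \<noteq> 0}"
      moreover have "pairing (h i) f = 0" if "\<forall>x\<in>{x. f x \<noteq> 0}. f x * h i x = 0"
        unfolding pairing_def using that by (rule sum.neutral)
      ultimately show "i \<in> (\<Union>x\<in>{x. f x \<noteq> 0}. {i. h i x \<noteq> 0})" by auto
    qed
    have "finite {i. h i x \<noteq> 0}" if "f x \<noteq> 0" for x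
    proof -
      have "x \<in> topspace X" using that f by (auto simp: flcs_carrier_def)
      from lf[OF this] show ?thesis by (auto elim: rev_finite_subset)
    qed
    then show "finite (\<Union>x\<in>{x. f x \<noteq> 0}. {i. h i x \<noteq> 0})"
      using f by (auto simp: flcs_carrier_def)
  qed
  then show "f \<in> flcs_carrier X \<Longrightarrow> finite {i. pairing (h i) f \<noteq> 0}" .
  \<comment> \<open>The index set varies with \<open>f\<close>; a common finite superset makes the
    values at different functions comparable.\<close>
  have eq: "(\<Sum>i | pairing (h i) f \<noteq> 0. \<bar>pairing (h i) f\<bar>) = (\<Sum>i\<in>I. \<bar>pairing (h i) f\<bar>)"
    if "finite I" "{i. pairing (h i) f \<noteq> 0} \<subseteq> I" for f I
    using that by (intro sum.mono_neutral_left) auto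
  show "flcs_seminorm X (\<lambda>f. \<Sum>i | pairing (h i) f \<noteq> 0. \<bar>pairing (h i) f\<bar>)"
    unfolding flcs_seminorm_def seminorm_on_def
  proof (intro conjI ballI allI impI)
    fix f g and c :: real assume f: "f \<in> flcs_carrier X"
    show "0 \<le> (\<Sum>i | pairing (h i) f \<noteq> 0. \<bar>pairing (h i) f\<bar>)" by (simp add: sum_nonneg)
    show "(\<Sum>i | pairing (h i) (\<lambda>x. c * f x) \<noteq> 0. \<bar>pairing (h i) (\<lambda>x. c * f x)\<bar>) =
        \<bar>c\<bar> * (\<Sum>i | pairing (h i) f \<noteq> 0. \<bar>pairing (h i) f\<bar>)"
      by (subst eq[OF fin[OF f]])
        (auto simp: pairing_scale[OF f] abs_mult sum_distrib_left)
    assume g: "g \<in> flcs_carrier X"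
    let ?I = "{i. pairing (h i) f \<noteq> 0} \<union> {i. pairing (h i) g \<noteq> 0}"
    have I: "finite ?I" using fin f g by simp
    have "(\<Sum>i | pairing (h i) (\<lambda>x. f x + g x) \<noteq> 0. \<bar>pairing (h i) (\<lambda>x. f x + g x)\<bar>)
        = (\<Sum>i\<in>?I. \<bar>pairing (h i) f + pairing (h i) g\<bar>)"
      by (subst eq[OF I]) (auto simp: pairing_add[OF f g])
    also have "\<dots> \<le> (\<Sum>i\<in>?I. \<bar>pairing (h i) f\<bar> + \<bar>pairing (h i) g\<bar>)"
      by (intro sum_mono abs_triangle_ineq)
    also have "\<dots> = (\<Sum>i | pairing (h i) f \<noteq> 0. \<bar>pairing (h i) f\<bar>) +
        (\<Sum>i | pairing (h i) g \<noteq> 0. \<bar>pairing (h i) g\<bar>)"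
      by (simp add: sum.distrib eq[OF I])
    finally show "(\<Sum>i | pairing (h i) (\<lambda>x. f x + g x) \<noteq> 0. \<bar>pairing (h i) (\<lambda>x. f x + g x)\<bar>)
        \<le> (\<Sum>i | pairing (h i) f \<noteq> 0. \<bar>pairing (h i) f\<bar>) +
          (\<Sum>i | pairing (h i) g \<noteq> 0. \<bar>pairing (h i) g\<bar>)" .
  next
    fix y and e :: real assume y: "y \<in> topspace X" and e: "0 < e"
    obtain W where W: "openin X W" "y \<in> W" "finite {i. \<exists>x\<in>W. h i x \<noteq> 0}"
      using lf[OF y] by blast
    define I where "I = {i. \<exists>x\<in>W. h i x \<noteq> 0}"
    \<comment> \<open>For \<open>x\<close> in \<open>W\<close> this is the value of the seminorm at
      the difference of the Dirac functions of \<open>x\<close> and \<open>y\<close>, written as a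
      fixed finite sum and hence continuous in \<open>x\<close>.\<close>
    define G where "G x = (\<Sum>i\<in>I. \<bar>h i x - h i y\<bar>)" for x
    have "continuous_map X euclideanreal G"
      unfolding G_def using W(3) cont
      by (intro continuous_map_sum continuous_map_real_abs continuous_map_diff) (auto simp: I_def)
    then have "openin X {x \<in> topspace X. G x \<in> {..<e}}"
      by (rule openin_continuous_map_preimage) simp
    moreover have "G x = (\<Sum>i | pairing (h i) (\<lambda>z. dirac x z - dirac y z) \<noteq> 0.
        \<bar>pairing (h i) (\<lambda>z. dirac x z - dirac y z)\<bar>)" if x: "x \<in> W" for x
    proof -
      have "x \<in> topspace X" using x W(1) openin_subset by blast
      then have d: "pairing (h i) (\<lambda>z. dirac x z - dirac y z) = h i x - h i y" for i
        using y by (subst pairing_diff[of _ X]) (auto simp: flcs_carrier_dirac pairing_dirac)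
      have "{i. h i x - h i y \<noteq> 0} \<subseteq> I"
        unfolding I_def by clarsimp (metis x W(2))
      then have "(\<Sum>i | h i x - h i y \<noteq> 0. \<bar>h i x - h i y\<bar>) = G x"
        unfolding G_def using W(3) by (intro sum.mono_neutral_left) (auto simp: I_def)
      then show ?thesis unfolding d by simp
    qed
    moreover have "G y = 0" by (simp add: G_def)
    ultimately show "\<exists>W. openin X W \<and> y \<in> W \<and> (\<forall>x\<in>W.
        (\<Sum>i | pairing (h i) (\<lambda>z. dirac x z - dirac y z) \<noteq> 0.
          \<bar>pairing (h i) (\<lambda>z. dirac x z - dirac y z)\<bar>) < e)"
      using W(1,2) y e
      by (intro exI[of _ "{x \<in> topspace X. G x \<in> {..<e}} \<inter> W"]) (auto intro!: openin_Int)
  qed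
qed

text \<open>The family with one member, indexed by \<open>unit\<close>; local finiteness is then
  automatic.\<close>

lemma flcs_seminorm_abs_pairing:
  assumes "continuous_map X euclideanreal h"
  shows "flcs_seminorm X (\<lambda>f. \<bar>pairing h f\<bar>)"
proof -
  have "(\<Sum>i::unit | pairing h f \<noteq> 0. \<bar>pairing h f\<bar>) = \<bar>pairing h f\<bar>" for f
    by (cases "pairing h f = 0") (auto simp: UNIV_unit)
  moreover have "flcs_seminorm X (\<lambda>f. \<Sum>i::unit | pairing h f \<noteq> 0. \<bar>pairing h f\<bar>)"
    using assms openin_topspace by (intro flcs_seminorm_sum_pairing(1)) auto
  ultimately show ?thesis by presburger
qed

section \<open>Continuous seminorms on compact subsets of \<open>X\<close>\<close>

lemma compactin_finite_nhd_subcover: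
  assumes K: "compactin X K" and W: "\<And>y. y \<in> K \<Longrightarrow> openin X (W y) \<and> y \<in> W y"
  obtains F where "finite F" "F \<subseteq> K" "K \<subseteq> \<Union>(W ` F)"
proof -
  have "\<forall>T\<in>W ` K. openin X T" "K \<subseteq> \<Union>(W ` K)" using W by blast+
  then obtain \<F> where "finite \<F>" "\<F> \<subseteq> W ` K" "K \<subseteq> \<Union>\<F>"
    using K unfolding compactin_def by meson
  then show thesis using that by (metis finite_subset_image)
qed

text \<open>Near \<open>y\<close> the value of \<open>p\<close> at a Dirac function exceeds
  \<open>p (dirac y)\<close> by less than 1; compactness leaves finitely many
  \<open>y\<close>.\<close>

lemma compactin_flcs_seminorm_dirac_bounded:
  assumes p: "flcs_seminorm X p" and K: "compactin X K"
  shows "\<exists>M. \<forall>x\<in>K. p (dirac x) \<le> M"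
proof -
  have KX: "K \<subseteq> topspace X" using K compactin_subset_topspace by blast
  have "\<exists>W. openin X W \<and> y \<in> W \<and> (\<forall>x\<in>W. p (\<lambda>z. dirac x z - dirac y z) < 1)"
    if "y \<in> K" for y
    using p that KX unfolding flcs_seminorm_def by (meson subsetD zero_less_one)
  then obtain W where W: "\<And>y. y \<in> K \<Longrightarrow> openin X (W y) \<and> y \<in> W y \<and>
      (\<forall>x\<in>W y. p (\<lambda>z. dirac x z - dirac y z) < 1)" by metis
  obtain F where F: "finite F" "F \<subseteq> K" "K \<subseteq> \<Union>(W ` F)"
    using compactin_finite_nhd_subcover[OF K, of W] W by blast
  show ?thesis
  proof (intro exI ballI)
    fix x assume x: "x \<in> K"
    then obtain y where y: "y \<in> F" "x \<in> W y" using F by blast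
    have c: "dirac x \<in> flcs_carrier X" "dirac z \<in> flcs_carrier X" if "z \<in> F" for z
      using x that F(2) KX by (auto intro: flcs_carrier_dirac)
    have "p (dirac x) \<le> p (\<lambda>z. dirac x z - dirac y z) + p (dirac y)"
      using flcs_seminorm_triangle_diff[OF p c[OF y(1)] flcs_carrier_zero] by simp
    also have "\<dots> \<le> 1 + p (dirac y)" using W y F(2) by (simp add: less_imp_le subset_iff)
    also have "p (dirac y) \<le> (\<Sum>z\<in>F. p (dirac z))"
      using F(1) y(1) flcs_seminorm_nonneg[OF p c(2)] by (intro member_le_sum) auto
    finally show "p (dirac x) \<le> 1 + (\<Sum>z\<in>F. p (dirac z))" by simp
  qed
qed

section \<open>The free locally convex topology and the weak topology\<close>

lemma openin_flcs_ball:
  assumes "flcs_seminorm X p" "f \<in> flcs_carrier X" "e > 0"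
  shows "openin (flcs_topology X) {g \<in> flcs_carrier X. p (\<lambda>z. g z - f z) < e}"
  unfolding flcs_topology_def by (rule topology_generated_by_Basis) (use assms in blast)

lemma topspace_flcs_topology: "topspace (flcs_topology X) = flcs_carrier X"
proof
  show "topspace (flcs_topology X) \<subseteq> flcs_carrier X"
    unfolding flcs_topology_def topology_generated_by_topspace by blast
  show "flcs_carrier X \<subseteq> topspace (flcs_topology X)"
    using openin_subset[OF openin_flcs_ball[OF flcs_seminorm_const_0 flcs_carrier_zero, of 1 X]]
    by simp
qed

text \<open>The generating balls form a subbase with arbitrary centres. Induction over the
  generation of \<open>N\<close> yields a ball centred at \<open>f\<close>: sums of seminorms treat
  intersections, and the triangle inequality recentres a ball at the cost of a smaller
  radius.\<close>

lemma openin_flcs_topology_imp_ball: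
  assumes "openin (flcs_topology X) N" "f \<in> N"
  shows "\<exists>p e. flcs_seminorm X p \<and> e > 0 \<and> {g \<in> flcs_carrier X. p (\<lambda>z. g z - f z) < e} \<subseteq> N"
proof -
  have "generate_topology_on {{g \<in> flcs_carrier X. p (\<lambda>z. g z - f z) < e} | p f e.
        flcs_seminorm X p \<and> f \<in> flcs_carrier X \<and> e > 0} N"
    using assms(1) unfolding flcs_topology_def by (rule openin_topology_generated_by)
  then show ?thesis using assms(2)
  proof (induction N)
    case (Int a b)
    then have fX: "f \<in> flcs_carrier X"
      using openin_subset[of "flcs_topology X" a] unfolding topspace_flcs_topology
      by (auto simp: flcs_topology_def openin_topology_generated_by_iff)
    obtain p e where p: "flcs_seminorm X p" "e > 0" "{g \<in> flcs_carrier X. p (\<lambda>z. g z - f z) < e} \<subseteq> a"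
      using Int.IH(1)[OF IntD1[OF Int.prems]] by (elim exE conjE)
    obtain q d where q: "flcs_seminorm X q" "d > 0" "{g \<in> flcs_carrier X. q (\<lambda>z. g z - f z) < d} \<subseteq> b"
      using Int.IH(2)[OF IntD2[OF Int.prems]] by (elim exE conjE)
    have "p (\<lambda>z. g z - f z) \<ge> 0" "q (\<lambda>z. g z - f z) \<ge> 0" if "g \<in> flcs_carrier X" for g
      using p q flcs_carrier_diff[OF that fX] flcs_seminorm_nonneg by blast+
    then have "{g \<in> flcs_carrier X. p (\<lambda>z. g z - f z) + q (\<lambda>z. g z - f z) < min e d} \<subseteq> a \<inter> b"
      using p(3) q(3) by fastforce
    with flcs_seminorm_add[OF p(1) q(1)] p(2) q(2) show ?case
      by (intro exI[of _ "\<lambda>g. p g + q g"] exI[of _ "min e d"]) auto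
  next
    case (UN K)
    then obtain k where k: "k \<in> K" "f \<in> k" by blast
    obtain p e where "flcs_seminorm X p" "e > 0" "{g \<in> flcs_carrier X. p (\<lambda>z. g z - f z) < e} \<subseteq> k"
      using UN.IH[OF k] by (elim exE conjE)
    with k(1) show ?case by (intro exI[of _ p] exI[of _ e]) auto
  next
    case (Basis s)
    then obtain p f0 e where p: "flcs_seminorm X p" "f0 \<in> flcs_carrier X" "e > 0"
      and s: "s = {g \<in> flcs_carrier X. p (\<lambda>z. g z - f0 z) < e}" by blast
    have f: "f \<in> flcs_carrier X" "p (\<lambda>z. f z - f0 z) < e" using Basis s by auto
    have "p (\<lambda>z. g z - f0 z) < e" if "g \<in> flcs_carrier X" "p (\<lambda>z. g z - f z) < e - p (\<lambda>z. f z - f0 z)" for g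
      using flcs_seminorm_triangle_diff[OF p(1) that(1) f(1) p(2)] that(2) by simp
    with p(1) f(2) s show ?case
      by (intro exI[of _ p] exI[of _ "e - p (\<lambda>z. f z - f0 z)"]) auto
  qed simp
qed

text \<open>The factor with which the unit ball of \<open>p\<close> absorbs \<open>B\<close> bounds
  \<open>p\<close> on \<open>B\<close>. Conversely, every neighbourhood of 0 contains a ball of a
  continuous seminorm, and a bound for that seminorm gives an absorbing factor.\<close>

lemma flcs_bounded_iff:
  "flcs_bounded X B \<longleftrightarrow>
    B \<subseteq> flcs_carrier X \<and> (\<forall>p. flcs_seminorm X p \<longrightarrow> (\<exists>M. \<forall>b\<in>B. p b \<le> M))"
proof (intro iffI conjI allI impI)
  assume B: "flcs_bounded X B"
  show BX: "B \<subseteq> flcs_carrier X" using B by (simp add: flcs_bounded_def)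
  fix p assume p: "flcs_seminorm X p"
  define N where "N = {g \<in> flcs_carrier X. p (\<lambda>z. g z - 0) < 1}"
  have "openin (flcs_topology X) N"
    unfolding N_def by (rule openin_flcs_ball[OF p flcs_carrier_zero]) simp
  moreover have "(\<lambda>_. 0) \<in> N"
    using p by (simp add: N_def flcs_seminorm_zero flcs_carrier_zero)
  ultimately have "\<exists>t>0. \<forall>s. \<bar>s\<bar> \<ge> t \<longrightarrow> (\<forall>b\<in>B. (\<lambda>z. b z / s) \<in> N)"
    using B unfolding flcs_bounded_def by simp
  then obtain t where t: "t > 0" "\<And>s b. \<bar>s\<bar> \<ge> t \<Longrightarrow> b \<in> B \<Longrightarrow> (\<lambda>z. b z / s) \<in> N"
    by blast
  have "p b \<le> t" if "b \<in> B" for b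
  proof -
    have "p (\<lambda>z. (1/t) * b z) < 1" using t(2)[OF _ that, of t] t(1) by (simp add: N_def)
    moreover have "p (\<lambda>z. (1/t) * b z) = \<bar>1/t\<bar> * p b"
      by (rule flcs_seminorm_scale[OF p]) (use that BX in blast)
    ultimately have "p b / t < 1" using t(1) by simp
    then show ?thesis using t(1) by simp
  qed
  then show "\<exists>M. \<forall>b\<in>B. p b \<le> M" by blast
next
  assume *: "B \<subseteq> flcs_carrier X \<and> (\<forall>p. flcs_seminorm X p \<longrightarrow> (\<exists>M. \<forall>b\<in>B. p b \<le> M))"
  show "flcs_bounded X B"
    unfolding flcs_bounded_def
  proof (intro conjI allI impI)
    show "B \<subseteq> flcs_carrier X" using * by simp
    fix N assume N: "openin (flcs_topology X) N \<and> (\<lambda>_. 0) \<in> N"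
    obtain p e where p: "flcs_seminorm X p" "e > 0" "{g \<in> flcs_carrier X. p g < e} \<subseteq> N"
      using openin_flcs_topology_imp_ball[of X N "\<lambda>_. 0"] N by auto
    obtain M where M: "\<And>b. b \<in> B \<Longrightarrow> p b \<le> M" using * p(1) by blast
    \<comment> \<open>The summand 1 keeps the threshold positive when \<open>M = 0\<close> and makes
      the estimate below strict.\<close>
    have "(\<lambda>z. b z / s) \<in> N" if s: "\<bar>s\<bar> \<ge> \<bar>M\<bar> / e + 1" and b: "b \<in> B" for s b
    proof -
      have s0: "\<bar>s\<bar> > 0" "\<bar>M\<bar> / e < \<bar>s\<bar>"
        using s p(2) divide_nonneg_pos[of "\<bar>M\<bar>" e] by linarith+
      have bX: "b \<in> flcs_carrier X" using b * by blast
      have "p (\<lambda>z. (1/s) * b z) = p b / \<bar>s\<bar>"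
        using flcs_seminorm_scale[OF p(1) bX, of "1/s"] by simp
      also have "\<dots> \<le> \<bar>M\<bar> / \<bar>s\<bar>" using M[OF b] by (intro divide_right_mono) auto
      also have "\<dots> < e" using s0 p(2) by (simp add: field_simps)
      finally show ?thesis
        using p(3) flcs_carrier_scale[OF bX, of "1/s"] by auto
    qed
    moreover have "\<bar>M\<bar> / e + 1 > 0" using p(2) by (simp add: add_nonneg_pos)
    ultimately show "\<exists>t>0. \<forall>s. \<bar>s\<bar> \<ge> t \<longrightarrow> (\<forall>b\<in>B. (\<lambda>z. b z / s) \<in> N)" by blast
  qed
qed

section \<open>Continuous functionals and the weak topology\<close>

lemma flcs_dual_add:
  "\<phi> \<in> flcs_dual X \<Longrightarrow> f \<in> flcs_carrier X \<Longrightarrow> g \<in> flcs_carrier X \<Longrightarrow>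
    \<phi> (\<lambda>z. f z + g z) = \<phi> f + \<phi> g"
  by (simp add: flcs_dual_def)

lemma flcs_dual_scale:
  "\<phi> \<in> flcs_dual X \<Longrightarrow> f \<in> flcs_carrier X \<Longrightarrow> \<phi> (\<lambda>z. c * f z) = c * \<phi> f"
  by (simp add: flcs_dual_def)

text \<open>The absolute value of the pairing is a continuous seminorm, and one of its balls around
  each point fits into the preimage of an open set. This supplies the functionals that test the weak
  topology below.\<close>

lemma pairing_in_flcs_dual:
  assumes h: "continuous_map X euclideanreal h"
  shows "pairing h \<in> flcs_dual X"
proof -
  have "openin (flcs_topology X) {f \<in> flcs_carrier X. pairing h f \<in> T}" if T: "open T" for T
  proof (subst openin_subopen, intro ballI)
    fix f assume f: "f \<in> {f \<in> flcs_carrier X. pairing h f \<in> T}"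
    then obtain e where e: "e > 0" "\<And>v. \<bar>v - pairing h f\<bar> < e \<Longrightarrow> v \<in> T"
      using T unfolding open_dist dist_real_def by blast
    let ?N = "{g \<in> flcs_carrier X. \<bar>pairing h (\<lambda>z. g z - f z)\<bar> < e}"
    have "openin (flcs_topology X) ?N"
      using openin_flcs_ball[OF flcs_seminorm_abs_pairing[OF h]] f e by simp
    moreover have "f \<in> ?N" using f e by (simp add: pairing_def)
    moreover have "?N \<subseteq> {f \<in> flcs_carrier X. pairing h f \<in> T}"
      using f e(2) by (auto simp: pairing_diff)
    ultimately show "\<exists>N. openin (flcs_topology X) N \<and> f \<in> N \<and> N \<subseteq> {f \<in> flcs_carrier X. pairing h f \<in> T}"
      by blast
  qed
  then have "continuous_map (flcs_topology X) euclideanreal (pairing h)"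
    by (simp add: continuous_map_def topspace_flcs_topology)
  then show ?thesis
    by (simp add: flcs_dual_def pairing_add pairing_scale)
qed

lemma openin_flcs_weak_preimage:
  assumes "\<phi> \<in> flcs_dual X" "open T"
  shows "openin (flcs_weak_topology X) {f \<in> flcs_carrier X. \<phi> f \<in> T}"
  unfolding flcs_weak_topology_def by (rule topology_generated_by_Basis) (use assms in blast)

lemma topspace_flcs_weak_topology: "topspace (flcs_weak_topology X) = flcs_carrier X"
proof
  show "topspace (flcs_weak_topology X) \<subseteq> flcs_carrier X"
    unfolding flcs_weak_topology_def topology_generated_by_topspace by blast
  have "pairing (\<lambda>_. 0) \<in> flcs_dual X" by (rule pairing_in_flcs_dual) simp
  from openin_subset[OF openin_flcs_weak_preimage[OF this open_UNIV]]
  show "flcs_carrier X \<subseteq> topspace (flcs_weak_topology X)" by simp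
qed

section \<open>Tychonoff spaces\<close>

text \<open>By T1 the finite set \<open>F\<close> is closed, hence so is its union with the
  complement of \<open>U\<close>, and complete regularity separates \<open>y\<close> from it. The
  zeros on \<open>F\<close> let \<open>h\<close> pick out one coordinate of a finitely supported
  function.\<close>

lemma tychonoff_separation:
  assumes X: "tychonoff_space X" and U: "openin X U" "y \<in> U" and F: "finite F" "y \<notin> F"
  obtains h where "continuous_map X euclideanreal h" "h y = 1"
    "\<forall>x\<in>topspace X. 0 \<le> h x" "\<forall>x\<in>topspace X. x \<in> F \<or> x \<notin> U \<longrightarrow> h x = 0"
proof -
  let ?S = "topspace X - U \<union> (F \<inter> topspace X)"
  have "closedin X ?S"
    using X U F unfolding tychonoff_space_def t1_space_closedin_finite
    by (intro closedin_Un) auto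
  moreover have "y \<in> topspace X - ?S" using U F openin_subset by fastforce
  ultimately obtain f :: "'a \<Rightarrow> real" where f: "continuous_map X (top_of_set {0..1}) f" "f y = 0" "f ` ?S \<subseteq> {1}"
    using X unfolding tychonoff_space_def completely_regular_space_def by blast
  show thesis
  proof
    \<comment> \<open>Complete regularity gives a function that is 0 at \<open>y\<close> and 1 on
      the closed set, so it is reflected.\<close>
    show "continuous_map X euclideanreal (\<lambda>x. 1 - f x)"
      using f(1) by (intro continuous_map_diff) (auto simp: continuous_map_in_subtopology)
    show "1 - f y = 1" using f by simp
    show "\<forall>x\<in>topspace X. 0 \<le> 1 - f x"
      using f(1) unfolding continuous_map_in_subtopology by auto
    show "\<forall>x\<in>topspace X. x \<in> F \<or> x \<notin> U \<longrightarrow> 1 - f x = 0"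
      using f(3) by auto
  qed
qed

text \<open>A bump at \<open>y\<close> that vanishes at the other points of \<open>F\<close> reads
  off the coordinate at \<open>y\<close>. Coordinates thus become continuous functionals as long as
  the supports stay in a fixed finite set.\<close>

lemma flcs_coordinate_pairing:
  assumes X: "tychonoff_space X" and y: "y \<in> topspace X" and F: "finite F"
  obtains h where "continuous_map X euclideanreal h"
    "\<And>f. f \<in> flcs_carrier X \<Longrightarrow> {x. f x \<noteq> 0} \<subseteq> insert y F \<Longrightarrow> pairing h f = f y"
proof -
  \<comment> \<open>\<open>F\<close> may contain \<open>y\<close>, where \<open>h\<close> must not
    vanish.\<close>
  have F': "finite (F - {y})" "y \<notin> F - {y}" using F by auto
  obtain h where h: "continuous_map X euclideanreal h" "h y = 1" "\<forall>x\<in>topspace X. 0 \<le> h x"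
    "\<forall>x\<in>topspace X. x \<in> F - {y} \<or> x \<notin> topspace X \<longrightarrow> h x = 0"
    by (rule tychonoff_separation[OF X openin_topspace y F'])
  have "pairing h f = f y" if f: "f \<in> flcs_carrier X" "{x. f x \<noteq> 0} \<subseteq> insert y F" for f
  proof -
    have "pairing h f = (\<Sum>x\<in>insert y F. f x * h x)"
      using f(2) F by (intro pairing_eq_sum) auto
    also have "\<dots> = (\<Sum>x\<in>{y}. f x * h x)"
      using F f(1) h(4) by (intro sum.mono_neutral_right) (auto simp: flcs_carrier_def)
    finally show ?thesis using h(2) by simp
  qed
  with h(1) show thesis using that by blast
qed

text \<open>Distinct elements differ in some coordinate, which for these two is the value of one
  continuous functional. The purpose is that weakly compact sets are closed.\<close>

lemma Hausdorff_flcs_weak_topology: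
  assumes X: "tychonoff_space X"
  shows "Hausdorff_space (flcs_weak_topology X)"
  unfolding Hausdorff_space_def topspace_flcs_weak_topology
proof (intro allI impI, elim conjE)
  fix f g assume f: "f \<in> flcs_carrier X" and g: "g \<in> flcs_carrier X" and "f \<noteq> g"
  then obtain y where y: "f y \<noteq> g y" by blast
  let ?F = "{x. f x \<noteq> 0} \<union> {x. g x \<noteq> 0}"
  have "finite ?F" "y \<in> topspace X" using f g y unfolding flcs_carrier_def by force+
  then obtain h where h: "continuous_map X euclideanreal h"
    "\<And>f. f \<in> flcs_carrier X \<Longrightarrow> {x. f x \<noteq> 0} \<subseteq> insert y ?F \<Longrightarrow> pairing h f = f y"
    using flcs_coordinate_pairing[OF X] by metis
  have hf: "pairing h f = f y" "pairing h g = g y" using h(2) f g by auto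
  obtain S T where ST: "open S" "open T" "f y \<in> S" "g y \<in> T" "S \<inter> T = {}"
    using hausdorff[OF y] by blast
  let ?P = "\<lambda>S. {k \<in> flcs_carrier X. pairing h k \<in> S}"
  have "openin (flcs_weak_topology X) (?P S)" "openin (flcs_weak_topology X) (?P T)"
    using openin_flcs_weak_preimage[OF pairing_in_flcs_dual[OF h(1)]] ST by auto
  moreover have "f \<in> ?P S" "g \<in> ?P T" "disjnt (?P S) (?P T)"
    using f g hf ST by (auto simp: disjnt_def)
  ultimately show "\<exists>U V. openin (flcs_weak_topology X) U \<and> openin (flcs_weak_topology X) V \<and>
      f \<in> U \<and> g \<in> V \<and> disjnt U V" by blast
qed

text \<open>The box is the image of a cube in a finite power of the reals under extension by zero.
  This map is weakly continuous because every functional becomes a finite linear combination of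
  coordinates.\<close>

lemma compactin_flcs_weak_box:
  assumes F: "finite F" "F \<subseteq> topspace X"
  shows "compactin (flcs_weak_topology X) {f. (\<forall>x. x \<notin> F \<longrightarrow> f x = 0) \<and> (\<forall>x\<in>F. \<bar>f x\<bar> \<le> M)}"
proof -
  let ?P = "product_topology (\<lambda>_::'a. euclideanreal) F"
  \<comment> \<open>Points of the product are \<open>undefined\<close> outside \<open>F\<close>,
    while elements of the box must be 0 there.\<close>
  define \<Phi> where "\<Phi> c = (\<lambda>z. if z \<in> F then c z else (0::real))" for c
  have carr: "(\<lambda>z. if z \<in> G then c z else (0::real)) \<in> flcs_carrier X" if "G \<subseteq> F" for c G
    using that F unfolding flcs_carrier_def by (auto intro: finite_subset)
  have lin: "\<phi> (\<Phi> c) = (\<Sum>x\<in>F. c x * \<phi> (dirac x))" if \<phi>: "\<phi> \<in> flcs_dual X" for \<phi> c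
  proof -
    have "\<phi> (\<lambda>z. if z \<in> G then c z else 0) = (\<Sum>x\<in>G. c x * \<phi> (dirac x))" if "G \<subseteq> F" for G
      using finite_subset[OF that F(1)] that
    proof (induction G)
      case empty
      show ?case using flcs_dual_scale[OF \<phi> flcs_carrier_zero, of 0] by simp
    next
      case (insert x G)
      have d: "dirac x \<in> flcs_carrier X" using insert F by (auto intro: flcs_carrier_dirac)
      have "(\<lambda>z. if z \<in> insert x G then c z else 0) =
          (\<lambda>z. c x * dirac x z + (if z \<in> G then c z else 0))"
        using insert by (auto simp: dirac_def)
      then have "\<phi> (\<lambda>z. if z \<in> insert x G then c z else 0) =
          \<phi> (\<lambda>z. c x * dirac x z) + \<phi> (\<lambda>z. if z \<in> G then c z else 0)"
        using flcs_dual_add[OF \<phi> flcs_carrier_scale[OF d, of "c x"] carr[of G c]] insert.prems by simp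
      also have "\<phi> (\<lambda>z. c x * dirac x z) = c x * \<phi> (dirac x)"
        by (rule flcs_dual_scale[OF \<phi> d])
      finally show ?case using insert by simp
    qed
    then show ?thesis unfolding \<Phi>_def by blast
  qed
  have "continuous_map ?P (flcs_weak_topology X) \<Phi>"
    unfolding flcs_weak_topology_def
  proof (rule continuous_on_generated_topo)
    fix U assume "U \<in> {{f \<in> flcs_carrier X. \<phi> f \<in> T} | \<phi> T. \<phi> \<in> flcs_dual X \<and> open T}"
    then obtain \<phi> T where \<phi>: "\<phi> \<in> flcs_dual X" "open T" "U = {f \<in> flcs_carrier X. \<phi> f \<in> T}" by blast
    have "continuous_map ?P euclideanreal (\<lambda>c. \<Sum>x\<in>F. c x * \<phi> (dirac x))"
      using F(1) by (intro continuous_map_sum continuous_map_real_mult continuous_map_product_projection) auto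
    then have "openin ?P {c \<in> topspace ?P. (\<Sum>x\<in>F. c x * \<phi> (dirac x)) \<in> T}"
      using \<phi>(2) by (intro openin_continuous_map_preimage) auto
    also have "{c \<in> topspace ?P. (\<Sum>x\<in>F. c x * \<phi> (dirac x)) \<in> T} = \<Phi> -` U \<inter> topspace ?P"
      using carr[of F] by (auto simp: \<phi>(3) lin[OF \<phi>(1), symmetric] \<Phi>_def)
    finally show "openin ?P (\<Phi> -` U \<inter> topspace ?P)" .
  next
    have "\<Phi> ` topspace ?P \<subseteq> topspace (flcs_weak_topology X)"
      using carr[of F] by (auto simp: topspace_flcs_weak_topology \<Phi>_def)
    then show "\<Phi> ` topspace ?P \<subseteq> \<Union> {{f \<in> flcs_carrier X. \<phi> f \<in> T} | \<phi> T. \<phi> \<in> flcs_dual X \<and> open T}"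
      unfolding flcs_weak_topology_def topology_generated_by_topspace .
  qed
  moreover have "compactin ?P (F \<rightarrow>\<^sub>E {-M..M})"
    by (simp add: compactin_PiE)
  ultimately have "compactin (flcs_weak_topology X) (\<Phi> ` (F \<rightarrow>\<^sub>E {-M..M}))"
    by (rule image_compactin[rotated])
  also have "\<Phi> ` (F \<rightarrow>\<^sub>E {-M..M}) = {f. (\<forall>x. x \<notin> F \<longrightarrow> f x = 0) \<and> (\<forall>x\<in>F. \<bar>f x\<bar> \<le> M)}"
  proof (intro equalityI subsetI)
    fix f assume "f \<in> {f. (\<forall>x. x \<notin> F \<longrightarrow> f x = 0) \<and> (\<forall>x\<in>F. \<bar>f x\<bar> \<le> M)}"
    then have "f = \<Phi> (restrict f F)" "restrict f F \<in> F \<rightarrow>\<^sub>E {-M..M}"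
      by (auto simp: \<Phi>_def abs_le_iff minus_le_iff)
    then show "f \<in> \<Phi> ` (F \<rightarrow>\<^sub>E {-M..M})" by blast
  qed (auto simp: \<Phi>_def abs_le_iff minus_le_iff PiE_iff)
  finally show ?thesis .
qed

section \<open>Semi-reflexivity makes compact sets finite\<close>

text \<open>If every point of \<open>C\<close> had a neighbourhood visited at only finitely many
  indices, finitely many of these would cover \<open>C\<close> and exhaust all indices. Indices are
  counted, not values, so \<open>b\<close> may repeat.\<close>

lemma compactin_cluster_point:
  fixes b :: "nat \<Rightarrow> 'b"
  assumes C: "compactin Y C" and b: "\<And>n. b n \<in> C"
  obtains c where "c \<in> C" "\<And>N. openin Y N \<Longrightarrow> c \<in> N \<Longrightarrow> infinite {n. b n \<in> N}"
proof (rule ccontr)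
  assume "\<not> thesis"
  then have "\<forall>c\<in>C. \<exists>N. openin Y N \<and> c \<in> N \<and> finite {n. b n \<in> N}" using that by blast
  then obtain N where N: "\<And>c. c \<in> C \<Longrightarrow> openin Y (N c) \<and> c \<in> N c \<and> finite {n. b n \<in> N c}"
    by metis
  obtain F where F: "finite F" "F \<subseteq> C" "C \<subseteq> \<Union>(N ` F)"
    using compactin_finite_nhd_subcover[OF C, of N] N by blast
  have "finite (\<Union>c\<in>F. {n. b n \<in> N c})" using F N by auto
  moreover have "(\<Union>c\<in>F. {n. b n \<in> N c}) = UNIV" using F(3) b by blast
  ultimately show False by simp
qed

text \<open>The partial sums below aim at a measure with infinite support, which is no element of
  \<open>L(X)\<close>; weak compactness would nevertheless give them a cluster point there.\<close>

lemma flcs_semireflexive_imp_compactin_finite: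
  assumes X: "tychonoff_space X" and sr: "flcs_semireflexive X" and K: "compactin X K"
  shows "finite K"
proof (rule ccontr)
  assume "infinite K"
  then obtain x :: "nat \<Rightarrow> 'a" where x: "inj x" "range x \<subseteq> K"
    using infinite_countable_subset by blast
  have xX: "x k \<in> topspace X" for k using x K compactin_subset_topspace by blast
  \<comment> \<open>Positive weights with finite sum: each \<open>x k\<close> keeps a fixed mass,
    while every continuous seminorm stays bounded along the sequence.\<close>
  define b where "b n = (\<lambda>z. \<Sum>k\<le>n. (1/2)^k * dirac (x k) z)" for n
  have b0: "b 0 = dirac (x 0)" by (simp add: b_def)
  have bSuc: "b (Suc n) = (\<lambda>z. b n z + (1/2)^(Suc n) * dirac (x (Suc n)) z)" for n
    by (simp add: b_def)
  have d: "(\<lambda>z. c * dirac (x k) z) \<in> flcs_carrier X" for c k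
    by (intro flcs_carrier_scale flcs_carrier_dirac xX)
  have bX: "b n \<in> flcs_carrier X" for n
    by (induction n) (simp_all only: b0 bSuc flcs_carrier_dirac[OF xX] flcs_carrier_add[OF _ d])
  have pb: "pairing h (b n) = (\<Sum>k\<le>n. (1/2)^k * h (x k))" for h n
  proof (induction n)
    case (Suc n)
    have "pairing h (b (Suc n)) = pairing h (b n) + (1/2)^(Suc n) * h (x (Suc n))"
      unfolding bSuc
      by (simp only: pairing_add[OF bX d] pairing_scale[OF flcs_carrier_dirac[OF xX]] pairing_dirac)
    with Suc show ?case by simp
  qed (simp add: b0 pairing_dirac)
  have "flcs_bounded X (range b)"
    unfolding flcs_bounded_iff
  proof (intro conjI allI impI)
    show "range b \<subseteq> flcs_carrier X" using bX by blast
    fix p assume p: "flcs_seminorm X p"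
    obtain M where M: "\<And>k. p (dirac (x k)) \<le> M"
      using compactin_flcs_seminorm_dirac_bounded[OF p K] x(2) by blast
    have "0 \<le> M"
      using order_trans[OF flcs_seminorm_nonneg[OF p flcs_carrier_dirac[OF xX]] M] .
    \<comment> \<open>\<open>2 - (1/2)^n\<close> is the sum of the weights up to index
      \<open>n\<close>.\<close>
    have "p (b n) \<le> (2 - (1/2)^n) * M" for n
    proof (induction n)
      case (Suc n)
      have "p (b (Suc n)) \<le> p (b n) + p (\<lambda>z. (1/2)^(Suc n) * dirac (x (Suc n)) z)"
        unfolding bSuc by (rule flcs_seminorm_triangle[OF p bX d])
      also have "p (\<lambda>z. (1/2)^(Suc n) * dirac (x (Suc n)) z) = (1/2)^(Suc n) * p (dirac (x (Suc n)))"
        by (subst flcs_seminorm_scale[OF p flcs_carrier_dirac[OF xX]]) simp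
      also have "\<dots> \<le> (1/2)^(Suc n) * M" by (intro mult_left_mono M) simp
      finally have "p (b (Suc n)) \<le> (2 - (1/2)^n) * M + (1/2)^(Suc n) * M" using Suc by simp
      also have "\<dots> = (2 - (1/2)^(Suc n)) * M" by (simp add: algebra_simps)
      finally show ?case .
    qed (simp add: b0 M)
    moreover have "(2 - (1/2)^n) * M \<le> 2 * M" for n :: nat
      using \<open>0 \<le> M\<close> by (intro mult_right_mono) auto
    ultimately have "p (b n) \<le> 2 * M" for n
      by (meson order_trans)
    then show "\<exists>M. \<forall>f\<in>range b. p f \<le> M" by blast
  qed
  then have "compactin (flcs_weak_topology X) (flcs_weak_topology X closure_of range b)"
    using sr by (simp add: flcs_semireflexive_def)
  moreover have "b n \<in> flcs_weak_topology X closure_of range b" for n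
    using closure_of_subset[of "range b" "flcs_weak_topology X"] bX
    by (auto simp: topspace_flcs_weak_topology)
  ultimately obtain c where c: "c \<in> flcs_weak_topology X closure_of range b"
    "\<And>N. openin (flcs_weak_topology X) N \<Longrightarrow> c \<in> N \<Longrightarrow> infinite {n. b n \<in> N}"
    using compactin_cluster_point by metis
  have cX: "c \<in> flcs_carrier X"
    using c(1) by (simp add: in_closure_of topspace_flcs_weak_topology)
  then have fin: "finite {z. c z \<noteq> 0}" by (simp add: flcs_carrier_def)
  then have "\<not> range x \<subseteq> {z. c z \<noteq> 0}"
    using x(1) finite_subset range_inj_infinite by blast
  then obtain m where m: "x m \<notin> {z. c z \<noteq> 0}" by blast
  obtain h where h: "continuous_map X euclideanreal h" "h (x m) = 1"
    "\<forall>z\<in>topspace X. 0 \<le> h z"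
    "\<forall>z\<in>topspace X. z \<in> {z. c z \<noteq> 0} \<or> z \<notin> topspace X \<longrightarrow> h z = 0"
    by (rule tychonoff_separation[OF X openin_topspace xX fin m])
  have "pairing h c = 0"
    unfolding pairing_def using h(4) cX by (intro sum.neutral) (auto simp: flcs_carrier_def)
  \<comment> \<open>The functional vanishes at \<open>c\<close>, so it is below
    \<open>(1/2)^m\<close> at infinitely many \<open>b n\<close>, in particular for some
    \<open>n \<ge> m\<close>.\<close>
  then have "infinite {n. b n \<in> {f \<in> flcs_carrier X. pairing h f \<in> {..<(1/2)^m}}}"
    using cX by (intro c(2) openin_flcs_weak_preimage pairing_in_flcs_dual h) auto
  then obtain n where n: "n \<ge> m" "pairing h (b n) < (1/2)^m"
    by (auto simp: infinite_nat_iff_unbounded_le)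
  \<comment> \<open>All terms are nonnegative, and the term of index \<open>m\<close> alone is
    \<open>(1/2)^m\<close>.\<close>
  have "(1/2)^m * h (x m) \<le> (\<Sum>k\<le>n. (1/2)^k * h (x k))"
    using n(1) h(3) xX by (intro member_le_sum) auto
  with n(2) h(2) pb show False by simp
qed

section \<open>Supports of bounded sets\<close>

text \<open>Intersecting a square root of \<open>V\<close> with its converse makes it
  symmetric.\<close>

lemma uniformity_on_half:
  assumes "uniformity_on S U" "V \<in> U"
  obtains W where "W \<in> U" "W\<inverse> = W" "W O W \<subseteq> V"
proof -
  have "\<forall>V\<in>U. \<exists>W\<in>U. W O W \<subseteq> V" "\<forall>V\<in>U. V\<inverse> \<in> U" and Int: "\<forall>V\<in>U. \<forall>W\<in>U. V \<inter> W \<in> U"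
    using assms(1) unfolding uniformity_on_def by - (elim conjE, assumption)+
  then obtain W where W: "W \<in> U" "W\<inverse> \<in> U" "W O W \<subseteq> V" using assms(2) by meson
  show thesis
  proof
    show "W \<inter> W\<inverse> \<in> U" using Int W(1,2) by simp
    show "(W \<inter> W\<inverse>)\<inverse> = W \<inter> W\<inverse>" by auto
    show "(W \<inter> W\<inverse>) O (W \<inter> W\<inverse>) \<subseteq> V" using W(3) by fast
  qed
qed

text \<open>The section of \<open>V\<close> at \<open>x\<close> need not be open, so
  \<open>N\<close> is its uniform interior. If \<open>V'\<close> witnesses that \<open>y\<close> is
  in \<open>N\<close>, a square root of \<open>V'\<close> shows that all points close to
  \<open>y\<close> are in \<open>N\<close> too.\<close>

lemma compatible_uniformity_nhd:
  assumes XU: "compatible_uniformity X U" and x: "x \<in> topspace X" and V: "V \<in> U"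
  obtains N where "openin X N" "x \<in> N" "N \<subseteq> V `` {x}"
proof -
  have U: "uniformity_on (topspace X) U" using XU by (simp add: compatible_uniformity_def)
  define N where "N = {y \<in> topspace X. \<exists>V'\<in>U. V' `` {y} \<subseteq> V `` {x}}"
  have "\<exists>W\<in>U. W `` {y} \<subseteq> N" if y: "y \<in> N" for y
  proof -
    obtain V' where V': "V' \<in> U" "V' `` {y} \<subseteq> V `` {x}" using y unfolding N_def by blast
    obtain W where W: "W \<in> U" "W\<inverse> = W" "W O W \<subseteq> V'" by (rule uniformity_on_half[OF U V'(1)])
    have "W \<subseteq> topspace X \<times> topspace X" using U W(1) unfolding uniformity_on_def by blast
    moreover have "W `` {z} \<subseteq> V `` {x}" if "(y, z) \<in> W" for z
      using that V'(2) W(3) by blast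
    ultimately have "W `` {y} \<subseteq> N" unfolding N_def using W(1) by auto
    with W(1) show ?thesis by (rule bexI[rotated])
  qed
  then have "openin X N" using XU unfolding compatible_uniformity_def N_def by blast
  moreover have "x \<in> N" using x V unfolding N_def by blast
  moreover have "N \<subseteq> V `` {x}"
    using U unfolding N_def uniformity_on_def by (fastforce simp: Id_on_def)
  ultimately show thesis using that by blast
qed

text \<open>Otherwise the supports contain a sequence separated by \<open>V\<close>. Functions
  \<open>h n\<close> concentrated near its points form a locally finite family and yield a
  continuous seminorm, scaled to be at least \<open>n\<close> at \<open>b n\<close>.\<close>

lemma flcs_bounded_support_precompact:
  assumes X: "tychonoff_space X" and XU: "compatible_uniformity X U"
    and B: "flcs_bounded X B" and V: "V \<in> U"
  shows "\<exists>F. finite F \<and> (\<Union>b\<in>B. {x. b x \<noteq> 0}) \<subseteq> V `` F"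
proof (rule ccontr)
  define A where "A = (\<Union>b\<in>B. {x. b x \<noteq> 0})"
  assume "\<not> (\<exists>F. finite F \<and> (\<Union>b\<in>B. {x. b x \<noteq> 0}) \<subseteq> V `` F)"
  then have "\<forall>F. \<exists>x. finite F \<longrightarrow> x \<in> A \<and> x \<notin> V `` F" unfolding A_def by blast
  then obtain pick where pick: "\<And>F. finite F \<Longrightarrow> pick F \<in> A \<and> pick F \<notin> V `` F" by metis
  \<comment> \<open>The recursion runs over the set of points chosen so far, so that each new point
    avoids the \<open>V\<close>-neighbourhoods of all earlier ones.\<close>
  define S where "S = rec_nat {} (\<lambda>_ F. insert (pick F) F)"
  define a where "a n = pick (S n)" for n
  have S: "S n = a ` {..<n}" for n
    by (induction n) (auto simp: S_def a_def lessThan_Suc)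
  have "a n \<in> A \<and> a n \<notin> V `` (a ` {..<n})" for n
    using pick[of "a ` {..<n}"] a_def[of n] S[of n] by simp
  then have aA: "a n \<in> A" and aV: "m < n \<Longrightarrow> (a m, a n) \<notin> V" for m n
    by blast+
  have BX: "B \<subseteq> flcs_carrier X" using B by (simp add: flcs_bounded_def)
  have AX: "A \<subseteq> topspace X" using BX unfolding A_def flcs_carrier_def by blast
  have "\<exists>b\<in>B. b (a n) \<noteq> 0" for n using aA[of n] unfolding A_def by blast
  then obtain b where b: "\<And>n. b n \<in> B" "\<And>n. b n (a n) \<noteq> 0" by metis
  have bX: "b n \<in> flcs_carrier X" for n using b BX by blast
  have U: "uniformity_on (topspace X) U" using XU by (simp add: compatible_uniformity_def)
  \<comment> \<open>Two square roots in succession: four \<open>W\<close>-steps, as from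
    \<open>a i\<close> to \<open>a j\<close> by way of a common point \<open>y\<close>, stay within
    \<open>V\<close>.\<close>
  obtain V' where V': "V' \<in> U" "V'\<inverse> = V'" "V' O V' \<subseteq> V"
    by (rule uniformity_on_half[OF U V])
  obtain W where W: "W \<in> U" "W\<inverse> = W" "W O W \<subseteq> V'"
    by (rule uniformity_on_half[OF U V'(1)])
  have W4: "(p, t) \<in> V" if "(p, q) \<in> W" "(q, r) \<in> W" "(r, s) \<in> W" "(s, t) \<in> W" for p q r s t
    using that W(3) V'(3) by blast
  have Wsym: "(p, q) \<in> W \<Longrightarrow> (q, p) \<in> W" for p q using W(2) by blast
  have "\<exists>N. openin X N \<and> a n \<in> N \<and> N \<subseteq> W `` {a n}" for n
    using compatible_uniformity_nhd[OF XU _ W(1)] aA AX by (metis subsetD)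
  then obtain N where N: "\<And>n. openin X (N n)" "\<And>n. a n \<in> N n" "\<And>n. N n \<subseteq> W `` {a n}"
    by metis
  have "\<exists>g. continuous_map X euclideanreal g \<and> g (a n) = 1 \<and>
      (\<forall>x\<in>topspace X. x \<in> {x. b n x \<noteq> 0} - {a n} \<or> x \<notin> N n \<longrightarrow> g x = 0)" for n
  proof -
    have F: "finite ({x. b n x \<noteq> 0} - {a n})" "a n \<notin> {x. b n x \<noteq> 0} - {a n}"
      using bX by (simp_all add: flcs_carrier_def)
    obtain g where "continuous_map X euclideanreal g" "g (a n) = 1"
      "\<forall>x\<in>topspace X. 0 \<le> g x"
      "\<forall>x\<in>topspace X. x \<in> {x. b n x \<noteq> 0} - {a n} \<or> x \<notin> N n \<longrightarrow> g x = 0"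
      by (rule tychonoff_separation[OF X N(1,2) F])
    then show ?thesis by (intro exI[of _ g] conjI)
  qed
  then obtain g where g: "\<And>n. continuous_map X euclideanreal (g n)" "\<And>n. g n (a n) = 1"
    "\<And>n x. x \<in> topspace X \<Longrightarrow> x \<in> {x. b n x \<noteq> 0} - {a n} \<or> x \<notin> N n \<Longrightarrow> g n x = 0"
    by metis
  \<comment> \<open>The factor normalises the coefficient of \<open>b n\<close> at
    \<open>a n\<close>, so that the pairing with \<open>b n\<close> has absolute value
    \<open>n\<close>.\<close>
  define h where "h n x = (real n / \<bar>b n (a n)\<bar>) * g n x" for n x
  have hc: "continuous_map X euclideanreal (h n)" for n
    unfolding h_def by (intro continuous_map_real_mult g) simp
  \<comment> \<open>The \<open>N n\<close> form a discrete family: \<open>W `` {y}\<close> meets at most one of them.\<close>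
  have lf: "\<exists>T. openin X T \<and> y \<in> T \<and> finite {n. \<exists>x\<in>T. h n x \<noteq> 0}" if y: "y \<in> topspace X" for y
  proof -
    obtain T where T: "openin X T" "y \<in> T" "T \<subseteq> W `` {y}"
      using compatible_uniformity_nhd[OF XU y W(1)] by blast
    define I where "I = {n. \<exists>x\<in>T. h n x \<noteq> 0}"
    have near: "(a n, z) \<in> W \<and> (z, y) \<in> W"
      if "z \<in> T" "h n z \<noteq> 0" for n z
    proof -
      have "z \<in> topspace X" using that(1) T(1) openin_subset by blast
      then have "z \<in> N n" using that(2) g(3)[of z n] unfolding h_def by auto
      then show ?thesis using N(3)[of n] T(3) that(1) Wsym by blast
    qed
    have "n = m" if nm: "n \<in> I" "m \<in> I" for n m
    proof -
      have close: "(a i, a j) \<in> V" if ij: "i \<in> I" "j \<in> I" for i j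
      proof -
        obtain s t where "s \<in> T" "h i s \<noteq> 0" "t \<in> T" "h j t \<noteq> 0" using ij unfolding I_def by blast
        then have "(a i, s) \<in> W" "(s, y) \<in> W" "(y, t) \<in> W" "(t, a j) \<in> W"
          using near[of s i] near[of t j] Wsym by simp_all
        then show ?thesis by (rule W4)
      qed
      \<comment> \<open>Separation is known only with the smaller index first, so closeness is used
        in both orders.\<close>
      show ?thesis using close[OF nm] close[OF nm(2,1)] aV by (meson linorder_neqE_nat)
    qed
    then have "\<exists>m. I \<subseteq> {m}" by blast
    then have "finite I" using finite_subset by blast
    with T(1,2) show ?thesis unfolding I_def by blast
  qed
  note p = flcs_seminorm_sum_pairing[where h = h, OF hc lf]
  obtain M where M: "\<And>f. f \<in> B \<Longrightarrow> (\<Sum>i | pairing (h i) f \<noteq> 0. \<bar>pairing (h i) f\<bar>) \<le> M"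
    using B p(1) unfolding flcs_bounded_iff by blast
  have "real n \<le> M" for n
  proof -
    have "pairing (h n) (b n) = (\<Sum>x\<in>{a n}. b n x * h n x)"
      unfolding pairing_def using bX[of n] b(2)[of n] g(3)[of _ n]
      by (intro sum.mono_neutral_right) (auto simp: flcs_carrier_def h_def)
    then have eq: "\<bar>pairing (h n) (b n)\<bar> = real n"
      using b(2)[of n] g(2)[of n] by (simp add: h_def abs_mult)
    \<comment> \<open>The index set omits vanishing terms, which is what happens for
      \<open>n = 0\<close>.\<close>
    have "\<bar>pairing (h n) (b n)\<bar> \<le> (\<Sum>i | pairing (h i) (b n) \<noteq> 0. \<bar>pairing (h i) (b n)\<bar>)"
    proof (cases "pairing (h n) (b n) = 0")
      case True
      then show ?thesis by (simp add: sum_nonneg)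
    next
      case False
      then show ?thesis
        by (intro member_le_sum[where f = "\<lambda>i. \<bar>pairing (h i) (b n)\<bar>"] p(2)[OF _ bX]) auto
    qed
    also have "\<dots> \<le> M" by (rule M[OF b(1)])
    finally show ?thesis using eq by simp
  qed
  then show False using reals_Archimedean2[of M] by (meson leD)
qed

section \<open>Precompact sets in complete uniform spaces\<close>

text \<open>A point of the closure is \<open>W\<close>-close to a point of \<open>A\<close>, which
  in turn is \<open>W\<close>-close to \<open>F\<close>.\<close>

lemma precompact_closure_of:
  assumes XU: "compatible_uniformity X U" and A: "A \<subseteq> topspace X"
    and pc: "\<And>V. V \<in> U \<Longrightarrow> \<exists>F. finite F \<and> A \<subseteq> V `` F" and V: "V \<in> U"
  shows "\<exists>F. finite F \<and> X closure_of A \<subseteq> V `` F"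
proof -
  have U: "uniformity_on (topspace X) U" using XU by (simp add: compatible_uniformity_def)
  obtain W where W: "W \<in> U" "W\<inverse> = W" "W O W \<subseteq> V" by (rule uniformity_on_half[OF U V])
  obtain F where F: "finite F" "A \<subseteq> W `` F" using pc[OF W(1)] by blast
  have "x \<in> V `` F" if x: "x \<in> X closure_of A" for x
  proof -
    have "x \<in> topspace X" using x by (simp add: in_closure_of)
    then obtain N where "openin X N" "x \<in> N" "N \<subseteq> W `` {x}"
      using compatible_uniformity_nhd[OF XU _ W(1)] by blast
    then obtain y where "y \<in> A" "(x, y) \<in> W" using x unfolding in_closure_of by blast
    then show ?thesis using F(2) W(2,3) by blast
  qed
  with F(1) show ?thesis by blast
qed

text \<open>The classical argument by ultrafilters. A cover without finite subcover is enlarged to a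
  maximal such family. The complements of its members generate a filter, Cauchy by precompactness,
  whose limit lies in a member of the cover although the filter contains the complement of that
  member.\<close>

lemma compactin_closure_of_precompact:
  assumes XU: "compatible_uniformity X U" and compl: "complete_uniformity X U"
    and A: "A \<subseteq> topspace X" and pc: "\<And>V. V \<in> U \<Longrightarrow> \<exists>F. finite F \<and> A \<subseteq> V `` F"
  shows "compactin X (X closure_of A)"
proof (rule ccontr)
  define C where "C = X closure_of A"
  have CX: "C \<subseteq> topspace X" by (simp add: C_def closure_of_subset_topspace)
  have U: "uniformity_on (topspace X) U" using XU by (simp add: compatible_uniformity_def)
  assume "\<not> compactin X (X closure_of A)"
  then have "\<exists>\<U>. Ball \<U> (openin X) \<and> C \<subseteq> \<Union>\<U> \<and>
      (\<forall>\<F>\<subseteq>\<U>. finite \<F> \<longrightarrow> \<not> C \<subseteq> \<Union>\<F>)"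
    using CX unfolding compactin_def C_def[symmetric] by simp
  then obtain \<U> where \<U>: "Ball \<U> (openin X)" "C \<subseteq> \<Union>\<U>"
    "\<forall>\<F>\<subseteq>\<U>. finite \<F> \<longrightarrow> \<not> C \<subseteq> \<Union>\<F>"
    by (elim exE conjE)
  \<comment> \<open>The added sets need not be open, so that maximality decides about arbitrary
    sets.\<close>
  define \<A> where "\<A> = {\<M>. \<U> \<subseteq> \<M> \<and> (\<forall>\<F>. finite \<F> \<and> \<F> \<subseteq> \<M> \<longrightarrow> \<not> C \<subseteq> \<Union>\<F>)}"
  have "\<exists>\<M>\<in>\<A>. \<forall>\<N>\<in>\<A>. \<M> \<subseteq> \<N> \<longrightarrow> \<N> = \<M>"
  proof (rule subset_Zorn_nonempty)
    show "\<A> \<noteq> {}" using \<U>(3) unfolding \<A>_def by blast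
    fix \<C> assume \<C>: "\<C> \<noteq> {}" "subset.chain \<A> \<C>"
    have "\<not> C \<subseteq> \<Union>\<F>" if \<F>: "finite \<F>" "\<F> \<subseteq> \<Union>\<C>" for \<F>
    proof -
      obtain \<M> where "\<M> \<in> \<C>" "\<F> \<subseteq> \<M>"
        using finite_subset_Union_chain[OF \<F> \<C>] by blast
      then show ?thesis using \<C>(2) \<F>(1) unfolding \<A>_def subset_chain_def by blast
    qed
    moreover have "\<U> \<subseteq> \<Union>\<C>"
    proof -
      obtain \<M> where "\<M> \<in> \<C>" using \<C>(1) by blast
      moreover from this have "\<U> \<subseteq> \<M>" using \<C>(2) unfolding \<A>_def subset_chain_def by blast
      ultimately show ?thesis by blast
    qed
    ultimately show "\<Union>\<C> \<in> \<A>" unfolding \<A>_def by simp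
  qed
  then obtain \<M> where \<M>: "\<M> \<in> \<A>" and max: "\<And>\<N>. \<N> \<in> \<A> \<Longrightarrow> \<M> \<subseteq> \<N> \<Longrightarrow> \<N> = \<M>" by blast
  have \<U>\<M>: "\<U> \<subseteq> \<M>" and nocover: "\<And>\<F>. finite \<F> \<Longrightarrow> \<F> \<subseteq> \<M> \<Longrightarrow> \<not> C \<subseteq> \<Union>\<F>"
    using \<M> unfolding \<A>_def by auto
  \<comment> \<open>The complements of the members of the maximal family generate an ultrafilter on \<open>C\<close>.\<close>
  define \<Phi> where "\<Phi> = (INF M\<in>insert {} \<M>. principal (C - M))"
  have ev: "eventually (\<lambda>x. x \<in> C - M) \<Phi>" if "M \<in> insert {} \<M>" for M
    unfolding \<Phi>_def using that by (intro eventually_INF1[OF that]) (simp add: eventually_principal)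
  have "\<Phi> \<noteq> bot"
    unfolding \<Phi>_def
  proof (rule INF_filter_not_bot)
    fix \<F> assume \<F>: "\<F> \<subseteq> insert {} \<M>" "finite \<F>"
    then have "\<not> C \<subseteq> \<Union>(\<F> - {{}})" by (intro nocover) auto
    then obtain x where "x \<in> C" "\<And>M. M \<in> \<F> \<Longrightarrow> x \<notin> M" by blast
    then have "principal {x} \<le> (INF M\<in>\<F>. principal (C - M))"
      by (intro INF_greatest) auto
    then show "(INF M\<in>\<F>. principal (C - M)) \<noteq> bot"
      by (metis bot.extremum_uniqueI insert_not_empty principal_eq_bot_iff)
  qed
  \<comment> \<open>By maximality, \<open>S\<close> and finitely many members of \<open>\<M>\<close>
    cover \<open>C\<close>; the filter avoids those members, so it is eventually in
    \<open>S\<close>.\<close>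
  have ultra: "eventually (\<lambda>x. x \<in> S) \<Phi>" if S: "S \<notin> \<M>" for S
  proof -
    have "insert S \<M> \<notin> \<A>" using max[of "insert S \<M>"] S by blast
    moreover have "\<U> \<subseteq> insert S \<M>" using \<U>\<M> by blast
    ultimately have "\<exists>\<F>. finite \<F> \<and> \<F> \<subseteq> insert S \<M> \<and> C \<subseteq> \<Union>\<F>"
      unfolding \<A>_def by simp
    then obtain \<F> where \<F>: "finite \<F>" "\<F> \<subseteq> insert S \<M>" "C \<subseteq> \<Union>\<F>"
      by (elim exE conjE)
    have "eventually (\<lambda>x. \<forall>M\<in>\<F> - {S}. x \<in> C - M) \<Phi>"
      using \<F> by (intro eventually_ball_finite ballI ev) auto
    moreover have "eventually (\<lambda>x. x \<in> C - {}) \<Phi>" by (rule ev) simp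
    ultimately show ?thesis
      by eventually_elim (use \<F>(3) in blast)
  qed
  have "cauchy_filter_unif (topspace X) U \<Phi>"
    unfolding cauchy_filter_unif_def
  proof (intro conjI ballI)
    show "\<Phi> \<noteq> bot" by fact
    show "eventually (\<lambda>x. x \<in> topspace X) \<Phi>"
      using ev[of "{}"] CX by (auto elim!: eventually_mono)
    fix V assume V: "V \<in> U"
    obtain W where W: "W \<in> U" "W\<inverse> = W" "W O W \<subseteq> V" by (rule uniformity_on_half[OF U V])
    obtain F where F: "finite F" "C \<subseteq> W `` F"
      using precompact_closure_of[OF XU A pc W(1)] unfolding C_def by blast
    \<comment> \<open>One of the finitely many \<open>W\<close>-sections covering \<open>C\<close>
      lies outside \<open>\<M>\<close>, hence in the filter; it is \<open>V\<close>-small because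
      \<open>W\<close> is symmetric.\<close>
    have "C \<subseteq> \<Union>((\<lambda>y. W `` {y}) ` F)" using F(2) by blast
    then have "\<not> (\<lambda>y. W `` {y}) ` F \<subseteq> \<M>" using nocover[of "(\<lambda>y. W `` {y}) ` F"] F(1) by fast
    then obtain y where "W `` {y} \<notin> \<M>" by blast
    then have "eventually (\<lambda>x. x \<in> W `` {y}) \<Phi>" by (rule ultra)
    moreover have "W `` {y} \<times> W `` {y} \<subseteq> V" using W(2,3) by blast
    ultimately show "\<exists>S. eventually (\<lambda>x. x \<in> S) \<Phi> \<and> S \<times> S \<subseteq> V" by blast
  qed
  then obtain x where x: "x \<in> topspace X"
    "\<And>N. openin X N \<Longrightarrow> x \<in> N \<Longrightarrow> eventually (\<lambda>y. y \<in> N) \<Phi>"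
    using compl unfolding complete_uniformity_def filter_converges_in_def by blast
  have clash: False if "eventually (\<lambda>y. y \<in> N) \<Phi>" "eventually (\<lambda>y. y \<in> C - N) \<Phi>" for N
  proof -
    have "eventually (\<lambda>y. False) \<Phi>" using that by eventually_elim simp
    then show False using \<open>\<Phi> \<noteq> bot\<close> by (simp add: trivial_limit_def)
  qed
  have "x \<in> C"
  proof (rule ccontr)
    assume "x \<notin> C"
    then have "eventually (\<lambda>y. y \<in> topspace X - C) \<Phi>"
      using x by (intro x(2)) (auto simp: C_def)
    moreover have "eventually (\<lambda>y. y \<in> C - (topspace X - C)) \<Phi>"
      using ev[of "{}"] by (auto elim!: eventually_mono)
    ultimately show False by (rule clash)
  qed
  then obtain T where T: "T \<in> \<U>" "x \<in> T" using \<U>(2) by blast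
  then show False using clash[OF x(2) ev] \<U>(1) \<U>\<M> by blast
qed

section \<open>Semi-reflexivity of \<open>L(X)\<close> for Dieudonne complete
  \<open>X\<close>\<close>

theorem theorem7p9:
  fixes X :: "'a topology"
  assumes "tychonoff_space X" and "dieudonne_complete X"
  shows "flcs_semireflexive X \<longleftrightarrow> (\<forall>K. compactin X K \<longrightarrow> finite K)"
proof
  assume "flcs_semireflexive X"
  then show "\<forall>K. compactin X K \<longrightarrow> finite K"
    using flcs_semireflexive_imp_compactin_finite[OF assms(1)] by blast
next
  assume fin: "\<forall>K. compactin X K \<longrightarrow> finite K"
  obtain U where U: "compatible_uniformity X U" "complete_uniformity X U"
    using assms(2) unfolding dieudonne_complete_def by blast
  show "flcs_semireflexive X"
    unfolding flcs_semireflexive_def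
  proof (intro allI impI)
    fix B assume B: "flcs_bounded X B"
    then have BX: "B \<subseteq> flcs_carrier X" by (simp add: flcs_bounded_def)
    define A where "A = (\<Union>b\<in>B. {x. b x \<noteq> 0})"
    have AX: "A \<subseteq> topspace X" using BX unfolding A_def flcs_carrier_def by blast
    have "compactin X (X closure_of A)"
      using flcs_bounded_support_precompact[OF assms(1) U(1) B]
      by (intro compactin_closure_of_precompact[OF U AX]) (simp add: A_def)
    then have "finite A" using fin closure_of_subset[OF AX] finite_subset by blast
    \<comment> \<open>All supports lie in the finite set \<open>A\<close>, so a coordinate is a
      pairing with a continuous function and hence bounded on \<open>B\<close>.\<close>
    have "\<exists>M. \<forall>b\<in>B. \<bar>b y\<bar> \<le> M" if y: "y \<in> A" for y
    proof -
      obtain h where h: "continuous_map X euclideanreal h"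
        "\<And>f. f \<in> flcs_carrier X \<Longrightarrow> {x. f x \<noteq> 0} \<subseteq> insert y A \<Longrightarrow> pairing h f = f y"
        using flcs_coordinate_pairing[OF assms(1) _ \<open>finite A\<close>] y AX by (metis subsetD)
      obtain M where "\<forall>b\<in>B. \<bar>pairing h b\<bar> \<le> M"
        using B flcs_seminorm_abs_pairing[OF h(1)] unfolding flcs_bounded_iff by blast
      moreover have "pairing h b = b y" if "b \<in> B" for b
        using that BX by (intro h(2)) (auto simp: A_def)
      ultimately show ?thesis by auto
    qed
    then obtain M where M: "\<And>y b. y \<in> A \<Longrightarrow> b \<in> B \<Longrightarrow> \<bar>b y\<bar> \<le> M y" by metis
    \<comment> \<open>The sum dominates each of the finitely many coordinate bounds, so one number
      serves for all of them.\<close>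
    let ?K = "{f. (\<forall>x. x \<notin> A \<longrightarrow> f x = 0) \<and> (\<forall>x\<in>A. \<bar>f x\<bar> \<le> (\<Sum>y\<in>A. \<bar>M y\<bar>))}"
    have K: "compactin (flcs_weak_topology X) ?K"
      by (rule compactin_flcs_weak_box[OF \<open>finite A\<close> AX])
    have "\<bar>b x\<bar> \<le> (\<Sum>y\<in>A. \<bar>M y\<bar>)" if "b \<in> B" "x \<in> A" for b x
    proof -
      have "\<bar>b x\<bar> \<le> \<bar>M x\<bar>" using M[OF that(2,1)] by simp
      also have "\<dots> \<le> (\<Sum>y\<in>A. \<bar>M y\<bar>)"
        using \<open>finite A\<close> that(2) by (intro member_le_sum) auto
      finally show ?thesis .
    qed
    then have "B \<subseteq> ?K" by (auto simp: A_def)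
    \<comment> \<open>The compact box is closed because the weak topology is Hausdorff, so it
      contains the closure of \<open>B\<close>.\<close>
    then have "flcs_weak_topology X closure_of B \<subseteq> ?K"
      using compactin_imp_closedin[OF Hausdorff_flcs_weak_topology[OF assms(1)] K]
      by (rule closure_of_minimal)
    with K show "compactin (flcs_weak_topology X) (flcs_weak_topology X closure_of B)"
      by (rule closed_compactin) simp
  qed
qed

end
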